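(* An ordered vector space over an ordered division ring cannot trace define an infinite field.
   Context: An ordered vector space over an ordered division ring $\mathbb{D}$ is an ordered abelian group $(V;+,<)$ with a $\mathbb{D}$-vector space structure, regarded as the structure $(V;+,<,(t\mapsto\lambda t)_{\lambda\in\mathbb{D}})$, in which multiplication by positive scalars preserves the order. For structures $\mathcal{M},\mathcal{O}$, $\mathcal{M}$ trace defines $\mathcal{O}$ if there is an injection $\tau\colon O\to M^m$ such that for every $\mathcal{O}$-definable (with parameters) $X\subseteq O^n$ there is an $\mathcal{M}$-definable (with parameters) $Y\subseteq M^{mn}$ with $(a_1,\dots,a_n)\in X\iff(\tau(a_1),\dots,\tau(a_n))\in Y$ for all $a_i\in O$. "Trace defines an infinite field" means trace defines some infinite field $(F;+,\times)$. *)

theory Defs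
  imports Main
begin

datatype 'f trm = Var nat | App 'f "'f trm list"

datatype ('f, 'r) fm =
    Eql "'f trm" "'f trm"
  | Rel 'r "'f trm list"
  | Neg "('f, 'r) fm"
  | Conj "('f, 'r) fm" "('f, 'r) fm"
  | Exi nat "('f, 'r) fm"

text \<open>A structure whose underlying set is the type \<open>'a\<close>. The first two fields list the symbols of
  its language together with their arities; the interpretation of a symbol is only meaningful on
  lists whose length is its arity.\<close>

record ('f, 'r, 'a) fo_structure =
  fun_symbols :: "('f \<times> nat) set"
  rel_symbols :: "('r \<times> nat) set"
  fun_interp :: "'f \<Rightarrow> 'a list \<Rightarrow> 'a"
  rel_interp :: "'r \<Rightarrow> 'a list \<Rightarrow> bool"

fun wf_trm :: "('f, 'r, 'a) fo_structure \<Rightarrow> 'f trm \<Rightarrow> bool" where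
  "wf_trm M (Var i) \<longleftrightarrow> True"
| "wf_trm M (App f ts) \<longleftrightarrow> (f, length ts) \<in> fun_symbols M \<and> (\<forall>t \<in> set ts. wf_trm M t)"

primrec wf_fm :: "('f, 'r, 'a) fo_structure \<Rightarrow> ('f, 'r) fm \<Rightarrow> bool" where
  "wf_fm M (Eql s t) \<longleftrightarrow> wf_trm M s \<and> wf_trm M t"
| "wf_fm M (Rel r ts) \<longleftrightarrow> (r, length ts) \<in> rel_symbols M \<and> (\<forall>t \<in> set ts. wf_trm M t)"
| "wf_fm M (Neg p) \<longleftrightarrow> wf_fm M p"
| "wf_fm M (Conj p q) \<longleftrightarrow> wf_fm M p \<and> wf_fm M q"
| "wf_fm M (Exi i p) \<longleftrightarrow> wf_fm M p"

primrec trm_val :: "('f, 'r, 'a) fo_structure \<Rightarrow> (nat \<Rightarrow> 'a) \<Rightarrow> 'f trm \<Rightarrow> 'a" where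
  "trm_val M e (Var i) = e i"
| "trm_val M e (App f ts) = fun_interp M f (map (trm_val M e) ts)"

primrec sat :: "('f, 'r, 'a) fo_structure \<Rightarrow> (nat \<Rightarrow> 'a) \<Rightarrow> ('f, 'r) fm \<Rightarrow> bool" where
  "sat M e (Eql s t) \<longleftrightarrow> trm_val M e s = trm_val M e t"
| "sat M e (Rel r ts) \<longleftrightarrow> rel_interp M r (map (trm_val M e) ts)"
| "sat M e (Neg p) \<longleftrightarrow> \<not> sat M e p"
| "sat M e (Conj p q) \<longleftrightarrow> sat M e p \<and> sat M e q"
| "sat M e (Exi i p) \<longleftrightarrow> (\<exists>a. sat M (e(i := a)) p)"

text \<open>\<open>definable M n X\<close>: the set \<open>X\<close> of \<open>n\<close>-tuples, encoded as lists of length \<open>n\<close>, is definable in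
  \<open>M\<close> with parameters. The variables \<open>0, \<dots>, n - 1\<close> stand for the coordinates, and the remaining free
  variables of the formula (finitely many) stand for the parameters, given by \<open>e\<close>.\<close>

definition definable :: "('f, 'r, 'a) fo_structure \<Rightarrow> nat \<Rightarrow> 'a list set \<Rightarrow> bool" where
  "definable M n X \<longleftrightarrow>
     (\<exists>p e. wf_fm M p \<and>
        X = {xs. length xs = n \<and> sat M (\<lambda>i. if i < n then xs ! i else e i) p})"

definition trace_defines ::
    "('f, 'r, 'a) fo_structure \<Rightarrow> ('g, 's, 'b) fo_structure \<Rightarrow> bool" where
  "trace_defines M N \<longleftrightarrow>
     (\<exists>m. \<exists>\<tau> :: 'b \<Rightarrow> 'a list. (\<forall>b. length (\<tau> b) = m) \<and> inj \<tau> \<and>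
        (\<forall>n X. definable N n X \<longrightarrow>
           (\<exists>Y. definable M (m * n) Y \<and>
              (\<forall>bs. length bs = n \<longrightarrow> (bs \<in> X \<longleftrightarrow> concat (map \<tau> bs) \<in> Y)))))"

text \<open>The library's \<open>module\<close> and \<open>vector_space\<close> locales require commutative scalars. The
  sort on \<open>'d\<close> is that of (not necessarily commutative) ordered division rings; the order on the
  group \<open>'v\<close> is linear.\<close>

locale ordered_vector_space =
  fixes scale ::
    "'d :: {division_ring, linordered_ring_strict} \<Rightarrow> 'v :: linordered_ab_group_add \<Rightarrow> 'v"
  assumes scale_right_distrib: "scale c (x + y) = scale c x + scale c y"
    and scale_left_distrib: "scale (c + d) x = scale c x + scale d x"
    and scale_scale: "scale c (scale d x) = scale (c * d) x"
    and scale_one: "scale 1 x = x"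
    and scale_strict_mono: "0 < c \<Longrightarrow> x < y \<Longrightarrow> scale c x < scale c y"

datatype 'd ovs_fun = VPlus | VScale 'd

datatype ovs_rel = VLess

fun ovs_fun_interp :: "('d \<Rightarrow> 'v \<Rightarrow> 'v :: plus) \<Rightarrow> 'd ovs_fun \<Rightarrow> 'v list \<Rightarrow> 'v" where
  "ovs_fun_interp scale VPlus [x, y] = x + y"
| "ovs_fun_interp scale (VScale c) [x] = scale c x"

fun ovs_rel_interp :: "ovs_rel \<Rightarrow> 'v :: ord list \<Rightarrow> bool" where
  "ovs_rel_interp VLess [x, y] \<longleftrightarrow> x < y"

definition ovs_structure ::
    "('d \<Rightarrow> 'v \<Rightarrow> 'v :: linordered_ab_group_add) \<Rightarrow> ('d ovs_fun, ovs_rel, 'v) fo_structure" where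
  "ovs_structure scale =
     \<lparr>fun_symbols = insert (VPlus, 2) (range (\<lambda>c. (VScale c, 1))),
      rel_symbols = {(VLess, 2)},
      fun_interp = ovs_fun_interp scale,
      rel_interp = ovs_rel_interp\<rparr>"

datatype field_fun = FPlus | FTimes

fun field_fun_interp :: "field_fun \<Rightarrow> 'k :: {plus, times} list \<Rightarrow> 'k" where
  "field_fun_interp FPlus [x, y] = x + y"
| "field_fun_interp FTimes [x, y] = x * y"

text \<open>The language of \<open>(F; +, \<times>)\<close> has no relation symbols; \<open>unit\<close> is only a placeholder.\<close>

definition field_structure :: "(field_fun, unit, 'k :: field) fo_structure" where
  "field_structure =
     \<lparr>fun_symbols = {(FPlus, 2), (FTimes, 2)},
      rel_symbols = {},
      fun_interp = field_fun_interp,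
      rel_interp = (\<lambda>_ _. False)\<rparr>"

end

theory Submission
  imports Defs
begin

text \<open>
  If an infinite field were trace definable, the incidence relation \<open>y = a x + b\<close> between points
  \<open>(x, y)\<close> and lines \<open>(a, b)\<close> would be the trace of a definable set of the ordered vector space.
  By quantifier elimination such a set is a boolean combination of conditions \<open>0 < t\<close> with \<open>t\<close>
  affine. Separating the coordinates of the point from those of the line turns each condition into
  \<open>0 < r P + s L\<close>, a relation in which the neighbourhoods of the points form a chain.
  A \<open>K\<^sub>2\<^sub>,\<^sub>2\<close>-free bipartite graph on \<open>n\<close> vertices that is a boolean combination of a
  fixed number \<open>s\<close> of such relations has \<open>O(n log\<^sup>s n)\<close> edges, by repeated halving of the vertex
  set (this is a simple case of the Zarankiewicz bounds for semilinear graphs). Over an infinite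
  field there are configurations with many more incidences: points \<open>A \<times> B'\<close> and lines \<open>A \<times> B\<close> with
  \<open>A A + B \<subseteq> B'\<close>, where \<open>A\<close> and \<open>B\<close> are initial segments of the natural numbers in characteristic
  zero and finite additive subgroups in positive characteristic.
\<close>

section \<open>Edge bounds for boolean combinations of Ferrers relations\<close>

text \<open>The neighbourhoods \<open>{y. R x y}\<close> are linearly ordered by inclusion.\<close>

definition ferrers :: "('a \<Rightarrow> 'b \<Rightarrow> bool) \<Rightarrow> bool" where
  "ferrers R \<longleftrightarrow> (\<forall>x x' y y'. R x y \<and> R x' y' \<longrightarrow> R x y' \<or> R x' y)"

definition edges :: "('a \<Rightarrow> 'b \<Rightarrow> bool) \<Rightarrow> 'a set \<Rightarrow> 'b set \<Rightarrow> ('a \<times> 'b) set" where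
  "edges E P L = {(x, y) \<in> P \<times> L. E x y}"

definition K22_free :: "('a \<Rightarrow> 'b \<Rightarrow> bool) \<Rightarrow> 'a set \<Rightarrow> 'b set \<Rightarrow> bool" where
  "K22_free E P L \<longleftrightarrow>
     (\<forall>x\<in>P. \<forall>x'\<in>P. \<forall>y\<in>L. \<forall>y'\<in>L. E x y \<and> E x y' \<and> E x' y \<and> E x' y' \<longrightarrow> x = x' \<or> y = y')"

text \<open>A semantic way to say that \<open>E\<close> is a boolean combination of
  \<open>Rs\<close> on \<open>P\<close> times \<open>L\<close>: the truth values of
  \<open>Rs\<close> at a pair fix that of \<open>E\<close>.\<close>

definition determined_by ::
    "('a \<Rightarrow> 'b \<Rightarrow> bool) list \<Rightarrow> ('a \<Rightarrow> 'b \<Rightarrow> bool) \<Rightarrow> 'a set \<Rightarrow> 'b set \<Rightarrow> bool" where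
  "determined_by Rs E P L \<longleftrightarrow>
     (\<forall>x\<in>P. \<forall>x'\<in>P. \<forall>y\<in>L. \<forall>y'\<in>L. (\<forall>R\<in>set Rs. R x y = R x' y') \<longrightarrow> E x y = E x' y')"

lemma finite_edges: "finite P \<Longrightarrow> finite L \<Longrightarrow> finite (edges E P L)"
  unfolding edges_def by (rule finite_subset[of _ "P \<times> L"]) auto

lemma K22_free_mono: "K22_free E P L \<Longrightarrow> P' \<subseteq> P \<Longrightarrow> L' \<subseteq> L \<Longrightarrow> K22_free E P' L'"
  unfolding K22_free_def by blast

lemma determined_byI:
  assumes "\<And>x x' y y'. x \<in> P \<Longrightarrow> x' \<in> P \<Longrightarrow> y \<in> L \<Longrightarrow> y' \<in> L \<Longrightarrow>
    (\<And>R. R \<in> set Rs \<Longrightarrow> R x y = R x' y') \<Longrightarrow> E x y = E x' y'"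
  shows "determined_by Rs E P L"
  unfolding determined_by_def
proof (intro ballI impI)
  fix x x' y y'
  assume mem: "x \<in> P" "x' \<in> P" "y \<in> L" "y' \<in> L" and R: "\<forall>R\<in>set Rs. R x y = R x' y'"
  show "E x y = E x' y'" by (rule assms[OF mem bspec[OF R]])
qed

lemma determined_byD:
  assumes "determined_by Rs E P L" "x \<in> P" "x' \<in> P" "y \<in> L" "y' \<in> L"
    and R: "\<And>R. R \<in> set Rs \<Longrightarrow> R x y = R x' y'"
  shows "E x y = E x' y'"
proof -
  have "\<forall>R\<in>set Rs. R x y = R x' y'" by (rule ballI) (rule R)
  then show ?thesis using assms(1-5) unfolding determined_by_def by blast
qed

lemma determined_by_mono:
  assumes "determined_by Rs E P L" "P' \<subseteq> P" "L' \<subseteq> L"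
  shows "determined_by Rs E P' L'"
  by (rule determined_byI, rule determined_byD[OF assms(1)])
    (assumption | erule subsetD[OF assms(2)] subsetD[OF assms(3)])+

lemma determined_by_drop_constant:
  assumes "determined_by (R # Rs) E P L" and b: "\<forall>x\<in>P. \<forall>y\<in>L. R x y = b"
  shows "determined_by Rs E P L"
proof (rule determined_byI, rule determined_byD[OF assms(1)], assumption+)
  fix x x' y y' S
  assume mem: "x \<in> P" "x' \<in> P" "y \<in> L" "y' \<in> L"
    and Rs: "\<And>S. S \<in> set Rs \<Longrightarrow> S x y = S x' y'" and "S \<in> set (R # Rs)"
  from set_ConsD[OF \<open>S \<in> set (R # Rs)\<close>] show "S x y = S x' y'"
  proof
    assume "S = R"
    moreover have "R x y = b" "R x' y' = b" using b mem by blast+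
    ultimately show ?thesis by simp
  qed (rule Rs)
qed

lemma determined_by_self: "determined_by [E] E P L"
proof (rule determined_byI)
  fix x x' y y'
  assume "\<And>R. R \<in> set [E] \<Longrightarrow> R x y = R x' y'"
  from this[OF list.set_intros(1)] show "E x y = E x' y'" .
qed

lemma determined_by_not:
  assumes "determined_by Rs E P L"
  shows "determined_by Rs (\<lambda>x y. \<not> E x y) P L"
  by (rule determined_byI, rule arg_cong[of _ _ Not], rule determined_byD[OF assms])

lemma determined_by_conj:
  assumes "determined_by Rs E P L" "determined_by Rs' E' P L"
  shows "determined_by (Rs @ Rs') (\<lambda>x y. E x y \<and> E' x y) P L"
proof (rule determined_byI, rule arg_cong2[of _ _ _ _ "(\<and>)"])
  fix x x' y y'
  assume mem: "x \<in> P" "x' \<in> P" "y \<in> L" "y' \<in> L"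
    and R: "\<And>R. R \<in> set (Rs @ Rs') \<Longrightarrow> R x y = R x' y'"
  show "E x y = E x' y'" by (rule determined_byD[OF assms(1) mem R]) simp
  show "E' x y = E' x' y'" by (rule determined_byD[OF assms(2) mem R]) simp
qed

text \<open>Take a point with the largest neighbourhood. The neighbourhoods form a chain, so it
  contains all others, and a \<open>y\<close> outside it is related to no point.\<close>

lemma ferrers_extremal:
  assumes R: "ferrers R" and "finite P" "finite L" "P \<noteq> {} \<or> L \<noteq> {}"
  shows "(\<exists>x\<in>P. \<forall>y\<in>L. R x y) \<or> (\<exists>y\<in>L. \<forall>x\<in>P. \<not> R x y)"
proof (cases "P = {}")
  case False
  define N where "N x = {y \<in> L. R x y}" for x
  have fin: "finite (N x)" for x using \<open>finite L\<close> by (simp add: N_def)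
  obtain x where "x \<in> P" and max: "card (N x) = Max ((\<lambda>x. card (N x)) ` P)"
    using obtains_MAX[OF \<open>finite P\<close> False] by metis
  have max_le: "card (N x') \<le> card (N x)" if "x' \<in> P" for x'
    using that \<open>finite P\<close> unfolding max by auto
  have sub: "N x' \<subseteq> N x" if "x' \<in> P" for x'
  proof (rule ccontr)
    assume "\<not> N x' \<subseteq> N x"
    then obtain y' where y': "y' \<in> L" "R x' y'" "\<not> R x y'" by (auto simp: N_def)
    with R have "N x \<subset> N x'" unfolding N_def ferrers_def by blast
    from psubset_card_mono[OF fin this] max_le[OF that] show False by simp
  qed
  show ?thesis
  proof (cases "N x = L")
    case True
    then show ?thesis using \<open>x \<in> P\<close> unfolding N_def by blast
  next
    case False
    then show ?thesis using sub unfolding N_def by blast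
  qed
qed (use assms in auto)

text \<open>Vertices are peeled off one at a time: a point related to all of \<open>L\<close> goes
  to \<open>P1\<close>, a \<open>y\<close> related to no point goes to \<open>L1\<close>. Either way
  the required relation to everything that remains holds.\<close>

lemma ferrers_split:
  assumes R: "ferrers R"
  shows "\<lbrakk>finite P; finite L; m \<le> card P + card L\<rbrakk> \<Longrightarrow>
    \<exists>P1 P2 L1 L2. P = P1 \<union> P2 \<and> P1 \<inter> P2 = {} \<and> L = L1 \<union> L2 \<and> L1 \<inter> L2 = {} \<and>
      card P1 + card L1 = m \<and> (\<forall>x\<in>P1. \<forall>y\<in>L2. R x y) \<and> (\<forall>x\<in>P2. \<forall>y\<in>L1. \<not> R x y)"
proof (induction m arbitrary: P L)
  case 0
  show ?case by (rule exI[of _ "{}"], rule exI[of _ P], rule exI[of _ "{}"], rule exI[of _ L]) auto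
next
  case (Suc m)
  then have "P \<noteq> {} \<or> L \<noteq> {}" by auto
  from ferrers_extremal[OF R Suc.prems(1,2) this] show ?case
  proof
    assume "\<exists>x\<in>P. \<forall>y\<in>L. R x y"
    then obtain x where x: "x \<in> P" "\<forall>y\<in>L. R x y" by blast
    have "m \<le> card (P - {x}) + card L" using Suc.prems x by (simp add: card_Diff_singleton)
    with Suc.IH[of "P - {x}" L] Suc.prems(1,2) obtain P1 P2 L1 L2 where
      h: "P - {x} = P1 \<union> P2" "P1 \<inter> P2 = {}" "L = L1 \<union> L2" "L1 \<inter> L2 = {}"
        "card P1 + card L1 = m" "\<forall>x\<in>P1. \<forall>y\<in>L2. R x y" "\<forall>x\<in>P2. \<forall>y\<in>L1. \<not> R x y"
      by auto
    have new: "finite P1" "x \<notin> P1" "x \<notin> P2"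
      using h(1) finite_Diff[OF Suc.prems(1), of "{x}"] by auto
    have "P = insert x P1 \<union> P2" using h(1) x(1) by blast
    with new h(2-7) x have "P = insert x P1 \<union> P2 \<and> insert x P1 \<inter> P2 = {} \<and> L = L1 \<union> L2 \<and>
        L1 \<inter> L2 = {} \<and> card (insert x P1) + card L1 = Suc m \<and>
        (\<forall>x\<in>insert x P1. \<forall>y\<in>L2. R x y) \<and> (\<forall>x\<in>P2. \<forall>y\<in>L1. \<not> R x y)" by auto
    then show ?thesis by blast
  next
    assume "\<exists>y\<in>L. \<forall>x\<in>P. \<not> R x y"
    then obtain y where y: "y \<in> L" "\<forall>x\<in>P. \<not> R x y" by blast
    have "m \<le> card P + card (L - {y})" using Suc.prems y
      by (metis Suc_le_mono add_Suc_right card_Suc_Diff1)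
    with Suc.IH[of P "L - {y}"] Suc.prems(1,2) obtain P1 P2 L1 L2 where
      h: "P = P1 \<union> P2" "P1 \<inter> P2 = {}" "L - {y} = L1 \<union> L2" "L1 \<inter> L2 = {}"
        "card P1 + card L1 = m" "\<forall>x\<in>P1. \<forall>y\<in>L2. R x y" "\<forall>x\<in>P2. \<forall>y\<in>L1. \<not> R x y"
      by auto
    have new: "finite L1" "y \<notin> L1" "y \<notin> L2"
      using h(3) finite_Diff[OF Suc.prems(2), of "{y}"] by auto
    have "L = insert y L1 \<union> L2" using h(3) y(1) by blast
    with new h(1,2,4-7) y have "P = P1 \<union> P2 \<and> P1 \<inter> P2 = {} \<and> L = insert y L1 \<union> L2 \<and>
        insert y L1 \<inter> L2 = {} \<and> card P1 + card (insert y L1) = Suc m \<and>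
        (\<forall>x\<in>P1. \<forall>y\<in>L2. R x y) \<and> (\<forall>x\<in>P2. \<forall>y\<in>insert y L1. \<not> R x y)" by auto
    then show ?thesis by blast
  qed
qed

text \<open>Freeness leaves at most one vertex on one of the sides, and
  \<open>a * b \<le> a + b\<close> once a factor is at most 1.\<close>

lemma card_edges_complete:
  assumes "K22_free E P L" "finite P" "finite L" and "\<And>x y. x \<in> P \<Longrightarrow> y \<in> L \<Longrightarrow> E x y"
  shows "card P * card L \<le> card P + card L"
proof -
  have "card P \<le> 1 \<or> card L \<le> 1"
  proof (rule ccontr)
    assume "\<not> ?thesis"
    then have "\<not> card P \<le> Suc 0" "\<not> card L \<le> Suc 0" by auto
    then obtain x x' y y' where "x \<in> P" "x' \<in> P" "x \<noteq> x'" "y \<in> L" "y' \<in> L" "y \<noteq> y'"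
      unfolding card_le_Suc0_iff_eq[OF assms(2)] card_le_Suc0_iff_eq[OF assms(3)] by blast
    then show False using assms(1,4) unfolding K22_free_def by blast
  qed
  moreover have "a * b \<le> a + b" if "a \<le> 1" for a b :: nat
    using mult_le_mono1[OF that, of b] by linarith
  ultimately show ?thesis
    using add.commute[of "card P"] mult.commute[of "card P"] by metis
qed

text \<open>Splitting the vertices into two halves along the chain of \<open>R\<close> makes \<open>R\<close> constant on the two mixed
  blocks, which therefore lose a relation. The two mixed blocks together have \<open>n\<close> vertices, as have
  the two unmixed ones, so that no constant factor accumulates.\<close>

lemma card_edges_bound:
  assumes "\<forall>R\<in>set Rs. ferrers R" "determined_by Rs E P L" "K22_free E P L"
    and "finite P" "finite L" "card P + card L \<le> 2 ^ k"
  shows "card (edges E P L) \<le> (card P + card L) * (k + 1) ^ length Rs"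
  using assms
proof (induction Rs arbitrary: P L k)
  case Nil
  \<comment> \<open>With no relations left, \<open>E\<close> is constant on \<open>P\<close> times
    \<open>L\<close>: the graph is complete or empty.\<close>
  show ?case
  proof (cases "\<exists>x\<in>P. \<exists>y\<in>L. E x y")
    case True
    moreover have "\<forall>R\<in>set []. R x y = R x' y'" for x y x' y' by simp
    ultimately have all: "E x y" if "x \<in> P" "y \<in> L" for x y
      using Nil.prems(2) that unfolding determined_by_def by metis
    have "edges E P L = P \<times> L" using all by (auto simp: edges_def)
    then show ?thesis using card_edges_complete[OF Nil.prems(3-5) all]
      by (simp add: card_cartesian_product)
  next
    case False
    then have "edges E P L = {}" by (auto simp: edges_def)
    then show ?thesis by simp
  qed
next
  case (Cons R Rs)
  have R: "ferrers R" and Rs: "\<forall>R\<in>set Rs. ferrers R" using Cons.prems(1) by auto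
  \<comment> \<open>An inner induction on \<open>k\<close>: the unmixed blocks have at most half the
    allowed vertices and use the bound for \<open>k\<close>; the mixed blocks use the outer
    hypothesis for \<open>Rs\<close>, still with \<open>Suc k\<close>.\<close>
  from Cons.prems(2-6) show ?case
  proof (induction k arbitrary: P L)
    case 0
    from 0(5) have "card P = 0 \<or> card L = 0" unfolding power_0 by linarith
    then have "P = {} \<or> L = {}" using 0 by auto
    then have "edges E P L = {}" by (auto simp: edges_def)
    then show ?case by simp
  next
    case (Suc k)
    let ?n = "card P + card L" and ?s = "length Rs"
    obtain P1 P2 L1 L2 where
      h: "P = P1 \<union> P2" "P1 \<inter> P2 = {}" "L = L1 \<union> L2" "L1 \<inter> L2 = {}"
        "card P1 + card L1 = ?n div 2" "\<forall>x\<in>P1. \<forall>y\<in>L2. R x y" "\<forall>x\<in>P2. \<forall>y\<in>L1. \<not> R x y"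
      using ferrers_split[OF R, of P L "?n div 2"] Suc.prems by auto
    have fin: "finite P1" "finite P2" "finite L1" "finite L2" using h Suc.prems(3,4) by auto
    have cP: "card P = card P1 + card P2" using h(1,2) fin by (simp add: card_Un_disjoint)
    have cL: "card L = card L1 + card L2" using h(3,4) fin by (simp add: card_Un_disjoint)
    have le1: "card P1 + card L1 \<le> 2 ^ k" using h(5) Suc.prems(5) by simp
    have le2: "card P2 + card L2 \<le> 2 ^ k" using h(5) cP cL Suc.prems(5) by simp
    have sub: "P1 \<subseteq> P" "P2 \<subseteq> P" "L1 \<subseteq> L" "L2 \<subseteq> L" using h by auto
    note det = determined_by_mono[OF Suc.prems(1)] and free = K22_free_mono[OF Suc.prems(2)]
    have b11: "card (edges E P1 L1) \<le> (card P1 + card L1) * (k + 1) ^ Suc ?s"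
      using Suc.IH[OF det[OF sub(1,3)] free[OF sub(1,3)] fin(1,3) le1] by simp
    have b22: "card (edges E P2 L2) \<le> (card P2 + card L2) * (k + 1) ^ Suc ?s"
      using Suc.IH[OF det[OF sub(2,4)] free[OF sub(2,4)] fin(2,4) le2] by simp
    have "determined_by Rs E P1 L2"
      using determined_by_drop_constant[OF det[OF sub(1,4)], of True] h(6) by blast
    then have b12: "card (edges E P1 L2) \<le> (card P1 + card L2) * (Suc k + 1) ^ ?s"
      using Cons.IH[OF Rs _ free[OF sub(1,4)] fin(1,4), of "Suc k"] Suc.prems(5) cP cL by simp
    have "determined_by Rs E P2 L1"
      using determined_by_drop_constant[OF det[OF sub(2,3)], of False] h(7) by blast
    then have b21: "card (edges E P2 L1) \<le> (card P2 + card L1) * (Suc k + 1) ^ ?s"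
      using Cons.IH[OF Rs _ free[OF sub(2,3)] fin(2,3), of "Suc k"] Suc.prems(5) cP cL by simp
    have "edges E P L = (edges E P1 L1 \<union> edges E P2 L2) \<union> (edges E P1 L2 \<union> edges E P2 L1)"
      using h(1,3) by (auto simp: edges_def)
    then have "card (edges E P L)
        \<le> card (edges E P1 L1 \<union> edges E P2 L2) + card (edges E P1 L2 \<union> edges E P2 L1)"
      by (simp only: card_Un_le)
    also have "\<dots> \<le> (card (edges E P1 L1) + card (edges E P2 L2))
        + (card (edges E P1 L2) + card (edges E P2 L1))"
      by (intro add_mono card_Un_le)
    also have "\<dots> \<le>
        ((card P1 + card L1) * (k + 1) ^ Suc ?s + (card P2 + card L2) * (k + 1) ^ Suc ?s)
        + ((card P1 + card L2) * (Suc k + 1) ^ ?s + (card P2 + card L1) * (Suc k + 1) ^ ?s)"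
      by (intro add_mono b11 b22 b12 b21)
    also have "\<dots> = ?n * (k + 1) ^ Suc ?s + ?n * (Suc k + 1) ^ ?s"
      unfolding cP cL by (simp only: distrib_right add_ac)
    \<comment> \<open>All but one of the factors \<open>k + 1\<close> grow to \<open>k + 2\<close>;
      then the coefficients \<open>k + 1\<close> and 1 add up to the missing
      \<open>k + 2\<close>.\<close>
    also have "\<dots> \<le> ?n * ((k + 1) * (Suc k + 1) ^ ?s) + ?n * (Suc k + 1) ^ ?s"
      unfolding power_Suc by (intro add_mono mult_le_mono power_mono) simp_all
    also have "\<dots> = ?n * (Suc k + 1) ^ length (R # Rs)"
      by (simp add: algebra_simps)
    finally show ?case .
  qed
qed

section \<open>Quantifier elimination in ordered vector spaces\<close>

context ordered_vector_space
begin

section \<open>Positive scalars and midpoints\<close>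

lemma scale_zero_left: "scale 0 x = 0"
  using scale_left_distrib[of 0 0 x] by simp

lemma scale_minus_left: "scale (- c) x = - scale c x"
  using scale_left_distrib[of c "- c" x] by (simp add: scale_zero_left eq_neg_iff_add_eq_0 add.commute)

lemma scalar_one_pos: "0 < (1 :: 'd)"
  using zero_le_square[of "1 :: 'd"] by (simp add: order_less_le)

lemma scalar_inverse_pos: "0 < inverse c" if "0 < c" for c :: 'd
proof (rule ccontr)
  assume "\<not> 0 < inverse c"
  then have "inverse c \<le> 0" by simp
  then have "inverse c * c \<le> 0" using that mult_nonpos_nonneg less_imp_le by blast
  moreover have "inverse c * c = 1" using that by (intro left_inverse) simp
  ultimately show False using scalar_one_pos by simp
qed

lemma less_scale_iff: "x < scale c y \<longleftrightarrow> scale (inverse c) x < y" if "0 < c"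
proof -
  have "scale (inverse c) (scale c y) = y" "scale c (scale (inverse c) x) = x"
    using that by (simp_all add: scale_scale scale_one)
  then show ?thesis
    using scale_strict_mono[OF that] scale_strict_mono[OF scalar_inverse_pos[OF that]] by metis
qed

lemma scale_less_iff: "scale c x < y \<longleftrightarrow> x < scale (inverse c) y" if "0 < c"
proof -
  have "scale (inverse c) (scale c x) = x" "scale c (scale (inverse c) y) = y"
    using that by (simp_all add: scale_scale scale_one)
  then show ?thesis
    using scale_strict_mono[OF that] scale_strict_mono[OF scalar_inverse_pos[OF that]] by metis
qed

definition midpoint :: "'v \<Rightarrow> 'v \<Rightarrow> 'v" where
  "midpoint x y = scale (inverse (1 + 1)) (x + y)"

lemma midpoint_between:
  assumes "x < y"
  shows "x < midpoint x y" "midpoint x y < y"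
proof -
  have two: "0 < (1 + 1 :: 'd)" by (rule add_pos_pos[OF scalar_one_pos scalar_one_pos])
  have double: "scale (1 + 1) z = z + z" for z by (simp only: scale_left_distrib scale_one)
  show "x < midpoint x y" "midpoint x y < y"
    using assms unfolding midpoint_def scale_less_iff[OF two, symmetric]
      less_scale_iff[OF two, symmetric] double by simp_all
qed

text \<open>Lets a breakpoint count as the midpoint of itself with itself, so that one-point cells
  fall under the same kind of sample point.\<close>

lemma midpoint_same: "midpoint x x = x"
proof -
  have two: "(1 + 1 :: 'd) \<noteq> 0"
    using add_pos_pos[OF scalar_one_pos scalar_one_pos] by simp
  have "x + x = scale (1 + 1) x" by (simp only: scale_left_distrib scale_one)
  then show ?thesis
    unfolding midpoint_def by (simp only: scale_scale scale_one left_inverse[OF two])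
qed

text \<open>Affine maps are taken semantically, as functions of a whole environment. The constants
  supply 0 and the shift by \<open>u\<close> in the elimination.\<close>

inductive affine :: "((nat \<Rightarrow> 'v) \<Rightarrow> 'v) \<Rightarrow> bool" where
  var: "affine (\<lambda>e. e i)"
| const: "affine (\<lambda>_. v)"
| add: "affine s \<Longrightarrow> affine t \<Longrightarrow> affine (\<lambda>e. s e + t e)"
| scale: "affine t \<Longrightarrow> affine (\<lambda>e. scale c (t e))"

text \<open>Strict positivity suffices as an atom: an equality says that neither the difference nor
  its negative is positive.\<close>

inductive semilinear :: "((nat \<Rightarrow> 'v) \<Rightarrow> bool) \<Rightarrow> bool" where
  pos: "affine t \<Longrightarrow> semilinear (\<lambda>e. 0 < t e)"
| neg: "semilinear p \<Longrightarrow> semilinear (\<lambda>e. \<not> p e)"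
| conj: "semilinear p \<Longrightarrow> semilinear q \<Longrightarrow> semilinear (\<lambda>e. p e \<and> q e)"

lemma affine_uminus: "affine t \<Longrightarrow> affine (\<lambda>e. - t e)"
  using affine.scale[of t "- 1"] by (simp add: scale_minus_left scale_one)

lemma affine_diff: "affine s \<Longrightarrow> affine t \<Longrightarrow> affine (\<lambda>e. s e - t e)"
  using affine.add[OF _ affine_uminus] by simp

lemma affine_midpoint: "affine s \<Longrightarrow> affine t \<Longrightarrow> affine (\<lambda>e. midpoint (s e) (t e))"
  unfolding midpoint_def by (intro affine.scale affine.add)

lemma affine_subst:
  assumes "affine s" "affine t"
  shows "affine (\<lambda>e. s (e(i := t e)))"
  using assms(1)
proof induction
  case (var j)
  show ?case using assms(2) by (cases "j = i") (auto intro: affine.var)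
qed (auto intro: affine.intros)

lemma semilinear_subst:
  assumes "semilinear p" "affine t"
  shows "semilinear (\<lambda>e. p (e(i := t e)))"
  using assms(1)
proof induction
  case (pos s)
  show ?case by (rule semilinear.pos[OF affine_subst[OF pos assms(2)]])
next
  case (neg p)
  from semilinear.neg[OF neg.IH] show ?case .
next
  case (conj p q)
  from semilinear.conj[OF conj.IH] show ?case .
qed

lemma affine_update:
  assumes "affine t"
  shows "\<exists>c. \<forall>e a. t (e(i := a)) = scale c a + t (e(i := 0))"
  using assms
proof induction
  case (var j)
  show ?case
    by (cases "j = i") (auto intro: exI[of _ 1] exI[of _ 0] simp: scale_one scale_zero_left)
next
  case (const v)
  show ?case by (auto intro: exI[of _ 0] simp: scale_zero_left)
next
  case (add s t)
  then obtain c d where h: "\<forall>e a. s (e(i := a)) = scale c a + s (e(i := 0))"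
    "\<forall>e a. t (e(i := a)) = scale d a + t (e(i := 0))" by blast
  have "s (e(i := a)) + t (e(i := a)) = scale (c + d) a + (s (e(i := 0)) + t (e(i := 0)))" for e a
    using h(1)[rule_format, of e a] h(2)[rule_format, of e a]
    by (simp only: scale_left_distrib ac_simps)
  then show ?case by blast
next
  case (scale t d)
  then obtain c where "\<forall>e a. t (e(i := a)) = scale c a + t (e(i := 0))" by blast
  then have "\<forall>e a. scale d (t (e(i := a))) = scale (d * c) a + scale d (t (e(i := 0)))"
    by (metis scale_right_distrib scale_scale)
  then show ?case by blast
qed

text \<open>The cells are the points of \<open>B\<close> and the open intervals that they cut out;
  equality with a point of \<open>B\<close> is the failure of both inequalities.\<close>

definition same_cell :: "'v set \<Rightarrow> 'v \<Rightarrow> 'v \<Rightarrow> bool" where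
  "same_cell B a b \<longleftrightarrow> (\<forall>t\<in>B. (t < a \<longleftrightarrow> t < b) \<and> (a < t \<longleftrightarrow> b < t))"

lemma same_cell_Un: "same_cell (A \<union> B) a b \<longleftrightarrow> same_cell A a b \<and> same_cell B a b"
  unfolding same_cell_def by blast

text \<open>Each atom is solved for variable \<open>i\<close>, and its root is an affine function of
  the other variables. The roots of all atoms are the breakpoints, so one finite \<open>T\<close>
  serves every \<open>e\<close>.\<close>

lemma semilinear_breakpoints:
  assumes "semilinear p"
  shows "\<exists>T. finite T \<and> (\<forall>t\<in>T. affine t) \<and>
    (\<forall>e a b. same_cell ((\<lambda>t. t e) ` T) a b \<longrightarrow> p (e(i := a)) = p (e(i := b)))"
  using assms
proof induction
  case (pos t)
  obtain c where c: "t (e(i := a)) = scale c a + t (e(i := 0))" for e a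
    using affine_update[OF pos, of i] by blast
  have aff: "affine (\<lambda>e. t (e(i := 0)))"
    by (rule affine_subst[OF pos affine.const])
  \<comment> \<open>By the sign of the coefficient, the atom ignores \<open>a\<close>, puts
    \<open>a\<close> above the root, or puts \<open>a\<close> below it.\<close>
  consider "c = 0" | "0 < c" | "0 < - c" by fastforce
  then show ?case
  proof cases
    case 1
    then have "t (e(i := a)) = t (e(i := b))" for e a b
      using c[of e a] c[of e b] by (simp add: scale_zero_left)
    then have "(0 < t (e(i := a))) = (0 < t (e(i := b)))" for e a b by metis
    then show ?thesis by (intro exI[of _ "{}"]) blast
  next
    case 2
    let ?r = "\<lambda>e. scale (inverse c) (- t (e(i := 0)))"
    have "0 < t (e(i := a)) \<longleftrightarrow> ?r e < a" for e a
      unfolding c[of e a] scale_less_iff[OF scalar_inverse_pos[OF 2]]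
      using add_less_cancel_right[of "- t (e(i := 0))" "t (e(i := 0))" "scale c a"] by simp
    then have "same_cell ((\<lambda>t. t e) ` {?r}) a b \<longrightarrow> (0 < t (e(i := a))) = (0 < t (e(i := b)))" for e a b
      unfolding same_cell_def by simp
    moreover have "affine ?r" by (intro affine.scale affine_uminus aff)
    ultimately show ?thesis by (intro exI[of _ "{?r}"]) blast
  next
    case 3
    let ?r = "\<lambda>e. scale (inverse (- c)) (t (e(i := 0)))"
    have "0 < t (e(i := a)) \<longleftrightarrow> a < ?r e" for e a
      unfolding c[of e a] scale_less_iff[OF 3, symmetric] scale_minus_left
      using add_less_cancel_left[of "scale c a" "- scale c a" "t (e(i := 0))"] by simp
    then have "same_cell ((\<lambda>t. t e) ` {?r}) a b \<longrightarrow> (0 < t (e(i := a))) = (0 < t (e(i := b)))" for e a b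
      unfolding same_cell_def by simp
    moreover have "affine ?r" by (intro affine.scale aff)
    ultimately show ?thesis by (intro exI[of _ "{?r}"]) blast
  qed
next
  case (neg p)
  then show ?case by blast
next
  case (conj p q)
  then obtain S T where
    "finite S" "\<forall>t\<in>S. affine t"
    "\<forall>e a b. same_cell ((\<lambda>t. t e) ` S) a b \<longrightarrow> p (e(i := a)) = p (e(i := b))"
    "finite T" "\<forall>t\<in>T. affine t"
    "\<forall>e a b. same_cell ((\<lambda>t. t e) ` T) a b \<longrightarrow> q (e(i := a)) = q (e(i := b))" by blast
  then show ?case
    by (intro exI[of _ "S \<union> T"], unfold image_Un same_cell_Un ball_Un finite_Un) blast
qed

text \<open>The sample point is \<open>a\<close> itself if it is a breakpoint, else the midpoint of
  the two adjacent breakpoints, a shift by \<open>u\<close> past the last or before the first, or 0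
  if there are none.\<close>

lemma same_cell_representative:
  assumes "finite B" "0 < u"
  shows "\<exists>b. same_cell B a b \<and>
    (b = 0 \<or> (\<exists>s\<in>B. b = s + u \<or> b = s - u \<or> (\<exists>t\<in>B. b = midpoint s t)))"
proof (cases "a \<in> B")
  case True
  then show ?thesis
    using midpoint_same[of a] by (intro exI[of _ a]) (force simp: same_cell_def)
next
  case False
  define lo where "lo = {t \<in> B. t < a}"
  define hi where "hi = {t \<in> B. a < t}"
  have fin: "finite lo" "finite hi" using assms by (auto simp: lo_def hi_def)
  have B: "B = lo \<union> hi" using False unfolding lo_def hi_def by (auto simp: not_less order_less_le)
  have cell: "same_cell B a b" if "\<And>t. t \<in> lo \<Longrightarrow> t < b" "\<And>t. t \<in> hi \<Longrightarrow> b < t" for b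
    using that unfolding same_cell_def B by (auto simp: lo_def hi_def dest: less_asym)
  consider "lo = {}" "hi = {}" | "lo \<noteq> {}" "hi = {}" | "lo = {}" "hi \<noteq> {}" | "lo \<noteq> {}" "hi \<noteq> {}"
    by blast
  then show ?thesis
  proof cases
    case 1
    then have "same_cell B a 0" by (intro cell) auto
    then show ?thesis by blast
  next
    case 2
    have "t < Max lo + u" if "t \<in> lo" for t
      using Max_ge[OF fin(1) that] assms(2) by (metis add_strict_increasing add.commute)
    then have "same_cell B a (Max lo + u)" using 2 by (intro cell) auto
    moreover have "Max lo \<in> B" using Max_in[OF fin(1) 2(1)] B by blast
    ultimately show ?thesis by blast
  next
    case 3
    have "Min hi - u < t" if "t \<in> hi" for t
      using Min_le[OF fin(2) that] assms(2)
      by (metis diff_less_eq less_add_same_cancel1 order_le_less_trans)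
    then have "same_cell B a (Min hi - u)" using 3 by (intro cell) auto
    moreover have "Min hi \<in> B" using Min_in[OF fin(2) 3(2)] B by blast
    ultimately show ?thesis by blast
  next
    case 4
    have mem: "Max lo \<in> lo" "Min hi \<in> hi" using fin 4 by auto
    then have "Max lo < Min hi" by (auto simp: lo_def hi_def)
    from midpoint_between[OF this] have "same_cell B a (midpoint (Max lo) (Min hi))"
      using fin by (intro cell) (auto intro: le_less_trans less_le_trans Max_ge Min_le)
    then show ?thesis using mem B by blast
  qed
qed

lemma semilinear_disj: "semilinear p \<Longrightarrow> semilinear q \<Longrightarrow> semilinear (\<lambda>e. p e \<or> q e)"
  using semilinear.neg[OF semilinear.conj[OF semilinear.neg semilinear.neg]] by simp

lemma semilinear_finite_Ex:
  assumes "finite T" "\<And>t. t \<in> T \<Longrightarrow> semilinear (q t)"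
  shows "semilinear (\<lambda>e. \<exists>t\<in>T. q t e)"
  using assms
proof (induction T)
  case empty
  show ?case using semilinear.pos[OF affine.const, of 0] by simp
next
  case (insert t T)
  then show ?case using semilinear_disj[of "q t"] by simp
qed

text \<open>The elimination evaluates \<open>p\<close> at one point of each cell of the line cut by the breakpoints.
  The positive element \<open>u\<close> reaches the two unbounded cells.\<close>

lemma semilinear_Ex:
  assumes "semilinear p" and u: "0 < (u :: 'v)"
  shows "semilinear (\<lambda>e. \<exists>a. p (e(i := a)))"
proof -
  obtain T where T: "finite T" "\<And>t. t \<in> T \<Longrightarrow> affine t"
    and cell: "\<And>e a b. same_cell ((\<lambda>t. t e) ` T) a b \<Longrightarrow> p (e(i := a)) = p (e(i := b))"
    using semilinear_breakpoints[OF assms(1), of i] by blast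
  define S where "S = insert (\<lambda>_. 0) ((\<lambda>s e. s e + u) ` T \<union> (\<lambda>s e. s e - u) ` T
      \<union> (\<lambda>(s, t) e. midpoint (s e) (t e)) ` (T \<times> T))"
  have fin: "finite S" using T(1) by (simp add: S_def)
  have aff: "affine s" if "s \<in> S" for s
    using that T(2) unfolding S_def
    by (auto intro!: affine.const affine.add affine_diff affine_midpoint)
  have "(\<exists>a. p (e(i := a))) \<longleftrightarrow> (\<exists>s\<in>S. p (e(i := s e)))" for e
  proof
    assume "\<exists>a. p (e(i := a))"
    then obtain a where a: "p (e(i := a))" ..
    obtain b where b: "same_cell ((\<lambda>t. t e) ` T) a b"
      "b = 0 \<or> (\<exists>s\<in>(\<lambda>t. t e) ` T. b = s + u \<or> b = s - u \<or> (\<exists>t\<in>(\<lambda>t. t e) ` T. b = midpoint s t))"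
      using same_cell_representative[OF _ u, of "(\<lambda>t. t e) ` T" a] T(1) by blast
    from b(2) have "\<exists>s\<in>S. b = s e"
      unfolding S_def by (auto simp: bex_Un)
    then show "\<exists>s\<in>S. p (e(i := s e))" using cell[OF b(1)] a by auto
  qed auto
  moreover have "semilinear (\<lambda>e. \<exists>s\<in>S. p (e(i := s e)))"
    by (intro semilinear_finite_Ex fin semilinear_subst assms(1) aff)
  ultimately show ?thesis by simp
qed

section \<open>From formulas to semilinear predicates\<close>

lemma affine_trm_val:
  "wf_trm (ovs_structure scale) t \<Longrightarrow> affine (\<lambda>e. trm_val (ovs_structure scale) e t)"
proof (induction t)
  case (Var i)
  show ?case by (simp add: affine.var)
next
  case (App f ts)
  show ?case
  proof (cases f)
    case VPlus
    with App.prems have "length ts = 2" by (auto simp: ovs_structure_def)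
    then obtain s t where "ts = [s, t]" by (auto simp: numeral_2_eq_2 length_Suc_conv)
    with VPlus App show ?thesis by (simp add: ovs_structure_def affine.add)
  next
    case (VScale c)
    with App.prems have "length ts = 1" by (auto simp: ovs_structure_def)
    then obtain t where "ts = [t]" by (auto simp: length_Suc_conv)
    with VScale App show ?thesis by (simp add: ovs_structure_def affine.scale)
  qed
qed

text \<open>Quantifier elimination in semantic form, with \<open>semilinear_Ex\<close> at each
  quantifier; \<open>u\<close> witnesses that the space is nontrivial.\<close>

lemma semilinear_sat:
  assumes u: "0 < (u :: 'v)" and "wf_fm (ovs_structure scale) p"
  shows "semilinear (\<lambda>e. sat (ovs_structure scale) e p)"
  using assms(2)
proof (induction p)
  case (Eql s t)
  let ?d = "\<lambda>s t e. trm_val (ovs_structure scale) e s - trm_val (ovs_structure scale) e t"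
  have "semilinear (\<lambda>e. \<not> 0 < ?d s t e \<and> \<not> 0 < ?d t s e)"
    using Eql by (intro semilinear.intros affine_diff affine_trm_val) auto
  moreover have "\<not> 0 < ?d s t e \<and> \<not> 0 < ?d t s e
      \<longleftrightarrow> trm_val (ovs_structure scale) e s = trm_val (ovs_structure scale) e t" for e
    by auto
  ultimately show ?case by simp
next
  case (Rel r ts)
  then have "length ts = 2" by (auto simp: ovs_structure_def)
  then obtain s t where ts: "ts = [s, t]" by (auto simp: numeral_2_eq_2 length_Suc_conv)
  have r: "r = VLess" by (cases r) simp
  have "semilinear (\<lambda>e. 0 < trm_val (ovs_structure scale) e t - trm_val (ovs_structure scale) e s)"
    using Rel by (intro semilinear.pos affine_diff affine_trm_val) (auto simp: ts)
  then show ?case unfolding ts r by (simp add: ovs_structure_def)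
qed (auto intro: semilinear.intros semilinear_Ex[OF _ u])

text \<open>An affine map is a sum of terms in single variables; each belongs to \<open>x\<close> or
  to \<open>y\<close> according to \<open>S\<close>, and constants are put with
  \<open>x\<close>.\<close>

lemma affine_split:
  fixes h :: "'x \<Rightarrow> 'y \<Rightarrow> nat \<Rightarrow> 'v"
  assumes "affine t" and h: "\<And>x y i. h x y i = (if S i then f x i else g y i)"
  shows "\<exists>r s. \<forall>x y. t (h x y) = r x + s y"
  using assms(1)
proof induction
  case (var i)
  show ?case
  proof (cases "S i")
    case True
    then have "\<forall>x y. h x y i = f x i + 0" by (simp add: h)
    then show ?thesis by (intro exI)
  next
    case False
    then have "\<forall>x y. h x y i = 0 + g y i" by (simp add: h)
    then show ?thesis by (intro exI)
  qed
next
  case (const v)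
  show ?case by (rule exI[of _ "\<lambda>_. v"], rule exI[of _ "\<lambda>_. 0"]) simp
next
  case (add t t')
  then obtain r s r' s' where t: "\<forall>x y. t (h x y) = r x + s y" "\<forall>x y. t' (h x y) = r' x + s' y"
    by (elim exE)
  have "\<forall>x y. t (h x y) + t' (h x y) = (r x + r' x) + (s y + s' y)"
    by (simp add: t ac_simps)
  then show ?case by (intro exI)
next
  case (scale t c)
  then obtain r s where t: "\<forall>x y. t (h x y) = r x + s y" by blast
  have "\<forall>x y. scale c (t (h x y)) = scale c (r x) + scale c (s y)"
    by (simp add: t scale_right_distrib)
  then show ?case by (intro exI)
qed

text \<open>The neighbourhood of \<open>x\<close> consists of the \<open>y\<close> with
  \<open>- r x < s y\<close> and grows with \<open>r x\<close>, so the neighbourhoods form a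
  chain.\<close>

lemma ferrers_pos_sum: "ferrers (\<lambda>x y. 0 < (r x + s y :: 'v))"
  unfolding ferrers_def
proof (intro allI impI)
  fix x x' y y'
  assume "0 < r x + s y \<and> 0 < r x' + s y'"
  moreover have "r x' + s y' \<le> r x + s y' \<or> r x + s y \<le> r x' + s y"
    using linear[of "r x" "r x'"] by auto
  ultimately show "0 < r x + s y' \<or> 0 < r x' + s y" by (meson less_le_trans)
qed

text \<open>\<open>Rs\<close> collects the atoms of \<open>p\<close>. It is valid on
  \<open>UNIV\<close>, so its length is fixed before any finite vertex sets are chosen.\<close>

lemma semilinear_determined_by_ferrers:
  fixes h :: "'x \<Rightarrow> 'y \<Rightarrow> nat \<Rightarrow> 'v"
  assumes "semilinear p" and h: "\<And>x y i. h x y i = (if S i then f x i else g y i)"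
  shows "\<exists>Rs. (\<forall>R\<in>set Rs. ferrers R) \<and> determined_by Rs (\<lambda>x y. p (h x y)) UNIV UNIV"
  using assms(1)
proof induction
  case (pos t)
  obtain r s where t: "\<forall>x y. t (h x y) = r x + s y" using affine_split[where h = h, OF pos h] by blast
  have "ferrers (\<lambda>x y. 0 < t (h x y))" using ferrers_pos_sum[of r s] t by simp
  then have "\<forall>R\<in>set [\<lambda>x y. 0 < t (h x y)]. ferrers R" by simp
  then show ?case using determined_by_self by blast
next
  case (neg p)
  then show ?case using determined_by_not by blast
next
  case (conj p q)
  then obtain Rs Rs' where R: "\<forall>R\<in>set Rs. ferrers R" "\<forall>R\<in>set Rs'. ferrers R"
    and det: "determined_by Rs (\<lambda>x y. p (h x y)) UNIV UNIV"
    "determined_by Rs' (\<lambda>x y. q (h x y)) UNIV UNIV" by blast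
  have "\<forall>R\<in>set (Rs @ Rs'). ferrers R" unfolding set_append ball_Un using R by blast
  then show ?case using determined_by_conj[OF det] by blast
qed

end

section \<open>Many incidences between points and lines over an infinite field\<close>

text \<open>With natural coefficients this is the generated submonoid. In positive characteristic it
  is a subgroup, since -1 is then a natural multiple of 1.\<close>

primrec additive_span :: "'k :: field list \<Rightarrow> 'k set" where
  "additive_span [] = {0}"
| "additive_span (g # gs) = (\<lambda>(n, v). of_nat n * g + v) ` (UNIV \<times> additive_span gs)"

lemma additive_span_ConsI: "v \<in> additive_span gs \<Longrightarrow> of_nat n * g + v \<in> additive_span (g # gs)"
  by force

lemma additive_span_zero: "0 \<in> additive_span gs"
proof (induction gs)
  case (Cons g gs)
  from additive_span_ConsI[OF this, of 0 g] show ?case by simp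
qed simp

lemma additive_span_add:
  "u \<in> additive_span gs \<Longrightarrow> v \<in> additive_span gs \<Longrightarrow> u + v \<in> additive_span gs"
proof (induction gs arbitrary: u v)
  case (Cons g gs)
  then obtain m n u' v' where h: "u = of_nat m * g + u'" "v = of_nat n * g + v'"
    "u' \<in> additive_span gs" "v' \<in> additive_span gs" by auto
  have "u + v = of_nat (m + n) * g + (u' + v')" by (simp add: h algebra_simps)
  then show ?case using additive_span_ConsI[OF Cons.IH[OF h(3,4)], of "m + n" g] by simp
qed simp

lemma additive_span_of_nat_mult: "v \<in> additive_span gs \<Longrightarrow> of_nat n * v \<in> additive_span gs"
  by (induction n) (simp_all add: additive_span_zero additive_span_add distrib_right)

lemma additive_span_append:
  "u \<in> additive_span gs \<Longrightarrow> v \<in> additive_span hs \<Longrightarrow> u + v \<in> additive_span (gs @ hs)"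
proof (induction gs arbitrary: u)
  case (Cons g gs)
  then obtain m u' where h: "u = of_nat m * g + u'" "u' \<in> additive_span gs" by auto
  from additive_span_ConsI[OF Cons.IH[OF h(2) Cons.prems(2)], of m g]
  show ?case by (simp only: h append_Cons add.assoc)
qed simp

lemma additive_span_scale: "v \<in> additive_span gs \<Longrightarrow> c * v \<in> additive_span (map ((*) c) gs)"
proof (induction gs arbitrary: v)
  case (Cons g gs)
  then obtain m u where h: "v = of_nat m * g + u" "u \<in> additive_span gs" by auto
  have "c * v = of_nat m * (c * g) + c * u" by (simp add: h algebra_simps)
  then show ?case using additive_span_ConsI[OF Cons.IH[OF h(2)], of m "c * g"] by simp
qed simp

text \<open>The products of generators form a list of length \<open>d * d\<close> if both lists have
  length \<open>d\<close>; hence the quadratic exponent of the grid.\<close>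

lemma additive_span_mult:
  "u \<in> additive_span gs \<Longrightarrow> v \<in> additive_span hs \<Longrightarrow>
    u * v \<in> additive_span (concat (map (\<lambda>g. map ((*) g) hs) gs))"
proof (induction gs arbitrary: u)
  case (Cons g gs)
  then obtain m u' where h: "u = of_nat m * g + u'" "u' \<in> additive_span gs" by auto
  have "u * v = of_nat m * (g * v) + u' * v" by (simp add: h algebra_simps)
  then show ?case
    using additive_span_append[OF additive_span_of_nat_mult[OF additive_span_scale[OF Cons.prems(2)]]
        Cons.IH[OF h(2) Cons.prems(2)], of m g] by simp
qed simp

lemma additive_span_Cons_bounded:
  assumes "of_nat p = (0 :: 'k :: field)" "0 < p"
  shows "additive_span ((g :: 'k) # gs) = (\<lambda>(n, v). of_nat n * g + v) ` ({..<p} \<times> additive_span gs)"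
proof -
  have red: "of_nat n = (of_nat (n mod p) :: 'k)" for n
  proof -
    have "of_nat n = (of_nat (p * (n div p) + n mod p) :: 'k)" by simp
    then show ?thesis using assms(1) by (simp only: of_nat_add of_nat_mult) simp
  qed
  show ?thesis
  proof
    show "additive_span (g # gs) \<subseteq> (\<lambda>(n, v). of_nat n * g + v) ` ({..<p} \<times> additive_span gs)"
    proof
      fix w assume "w \<in> additive_span (g # gs)"
      then obtain n v where "w = of_nat n * g + v" "v \<in> additive_span gs" by auto
      then have "w = of_nat (n mod p) * g + v" "(n mod p, v) \<in> {..<p} \<times> additive_span gs"
        using red[of n] assms(2) by auto
      then show "w \<in> (\<lambda>(n, v). of_nat n * g + v) ` ({..<p} \<times> additive_span gs)"
        by (intro image_eqI[of _ _ "(n mod p, v)"]) simp_all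
    qed
  qed auto
qed

lemma card_additive_span:
  assumes "of_nat p = (0 :: 'k :: field)" "0 < p"
  shows "finite (additive_span (gs :: 'k list)) \<and> card (additive_span gs) \<le> p ^ length gs"
proof (induction gs)
  case (Cons g gs)
  have "card (additive_span (g # gs)) \<le> card ({..<p} \<times> additive_span gs)"
    unfolding additive_span_Cons_bounded[OF assms] using Cons by (intro card_image_le) simp
  also have "\<dots> \<le> p * p ^ length gs"
    using Cons by (simp add: card_cartesian_product)
  finally show ?case
    using Cons unfolding additive_span_Cons_bounded[OF assms] by simp
qed simp

text \<open>An infinite field has a \<open>g\<close> outside the finite span built so far. Adding it
  brings in a disjoint translate, so each generator at least doubles the size.\<close>

lemma large_additive_span:
  assumes "of_nat p = (0 :: 'k :: field)" "0 < p" "infinite (UNIV :: 'k set)"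
  shows "\<exists>gs :: 'k list. length gs = d \<and> 2 ^ d \<le> card (additive_span gs)"
proof (induction d)
  case (Suc d)
  then obtain gs :: "'k list" where gs: "length gs = d" "2 ^ d \<le> card (additive_span gs)" by blast
  have fin: "finite (additive_span hs)" for hs :: "'k list"
    using card_additive_span[OF assms(1,2)] by blast
  obtain g where g: "g \<notin> additive_span gs" using fin assms(3) ex_new_if_finite by blast
  \<comment> \<open>\<open>p - 1\<close> acts as -1, so \<open>g + v\<close> and \<open>v\<close> in
    the span would put \<open>g\<close> there.\<close>
  have m1: "of_nat (p - 1) = (- 1 :: 'k)" using assms(1,2) by (simp add: of_nat_diff)
  have "(+) g ` additive_span gs \<inter> additive_span gs = {}"
  proof -
    have False if "v \<in> additive_span gs" "g + v \<in> additive_span gs" for v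
      using additive_span_add[OF that(2) additive_span_of_nat_mult[OF that(1), of "p - 1"]] g m1
      by simp
    then show ?thesis by blast
  qed
  moreover have "additive_span gs \<union> (+) g ` additive_span gs \<subseteq> additive_span (g # gs)"
    using additive_span_ConsI[of _ gs 0 g] additive_span_ConsI[of _ gs 1 g] by auto
  moreover have "card ((+) g ` additive_span gs) = card (additive_span gs)"
    by (intro card_image) simp
  ultimately have "2 * card (additive_span gs) \<le> card (additive_span (g # gs))"
    using card_mono[OF fin[of "g # gs"], of "additive_span gs \<union> (+) g ` additive_span gs"]
      card_Un_disjoint[OF fin[of gs] finite_imageI[OF fin[of gs], of "(+) g"]]
    by (simp add: Int_commute)
  then show ?case using gs by (intro exI[of _ "g # gs"]) simp
qed auto

text \<open>\<open>A\<close> is exponentially large in \<open>d\<close>, while the logarithm of the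
  number of lines \<open>card A * card B\<close> is at most quadratic in \<open>d\<close>;
  \<open>c\<close> is uniform in \<open>d\<close>.\<close>

lemma multiplicative_grid:
  assumes inf: "infinite (UNIV :: 'k :: field set)"
  shows "\<exists>c. \<forall>d. \<exists>A B B' :: 'k set. finite A \<and> finite B \<and> finite B' \<and> B \<noteq> {} \<and>
    (\<forall>a\<in>A. \<forall>x\<in>A. \<forall>b\<in>B. a * x + b \<in> B') \<and> card B' \<le> 2 * card B \<and>
    2 ^ d \<le> card A \<and> card A * card B \<le> 2 ^ (c * (d + 1)\<^sup>2)"
proof (cases "inj (of_nat :: nat \<Rightarrow> 'k)")
  case True
  have card: "card ((of_nat :: nat \<Rightarrow> 'k) ` {..<n}) = n" for n
    using card_image[OF inj_on_subset[OF True]] by simp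
  \<comment> \<open>\<open>A\<close>, \<open>B\<close>, \<open>B'\<close> are the images of the
    naturals below \<open>N\<close>, \<open>N * N\<close> and \<open>2 * (N * N)\<close> for
    \<open>N = 2 ^ d\<close>; the 3 comes from \<open>N * (N * N)\<close>.\<close>
  show ?thesis
  proof (intro exI[of _ 3] allI)
    fix d :: nat
    let ?N = "2 ^ d :: nat"
    have "of_nat a * of_nat x + of_nat b \<in> (of_nat :: nat \<Rightarrow> 'k) ` {..<2 * (?N * ?N)}"
      if "a < ?N" "x < ?N" "b < ?N * ?N" for a x b
    proof -
      have "a * x \<le> ?N * ?N" using that by (intro mult_le_mono) auto
      then have "a * x + b < 2 * (?N * ?N)" using that(3) by linarith
      then show ?thesis by (intro image_eqI[of _ _ "a * x + b"]) auto
    qed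
    then have "\<forall>a\<in>of_nat ` {..<?N}. \<forall>x\<in>of_nat ` {..<?N}. \<forall>b\<in>of_nat ` {..<?N * ?N}.
        a * x + b \<in> (of_nat :: nat \<Rightarrow> 'k) ` {..<2 * (?N * ?N)}" by blast
    moreover have "?N * (?N * ?N) \<le> 2 ^ (3 * (d + 1)\<^sup>2)"
      unfolding power_add[symmetric] by (intro power_increasing) (auto simp: power2_eq_square)
    moreover have "0 \<in> {..<?N * ?N}" by simp
    then have "(of_nat :: nat \<Rightarrow> 'k) ` {..<?N * ?N} \<noteq> {}" by blast
    ultimately show "\<exists>A B B' :: 'k set. finite A \<and> finite B \<and> finite B' \<and> B \<noteq> {} \<and>
        (\<forall>a\<in>A. \<forall>x\<in>A. \<forall>b\<in>B. a * x + b \<in> B') \<and> card B' \<le> 2 * card B \<and>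
        2 ^ d \<le> card A \<and> card A * card B \<le> 2 ^ (3 * (d + 1)\<^sup>2)"
      using card[of ?N] card[of "?N * ?N"] card[of "2 * (?N * ?N)"]
        finite_imageI[OF finite_lessThan, of "of_nat :: nat \<Rightarrow> 'k"]
      by (metis order_refl)
  qed
next
  case False
  then obtain i j :: nat where "of_nat i = (of_nat j :: 'k)" "i < j"
    unfolding inj_def by (metis linorder_neqE_nat)
  \<comment> \<open>\<open>p\<close> is the difference of two naturals with equal image, hence a
    positive multiple of the characteristic.\<close>
  then obtain p where p: "of_nat p = (0 :: 'k)" "0 < p"
    by (metis diff_self of_nat_diff order_less_imp_le zero_less_diff)
  show ?thesis
  proof (intro exI[of _ p] allI)
    fix d
    obtain gs :: "'k list" where gs: "length gs = d" "2 ^ d \<le> card (additive_span gs)"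
      using large_additive_span[OF p inf] by blast
    \<comment> \<open>The span of \<open>hs\<close> contains all products from the span of
      \<open>gs\<close> and is closed under addition, so it serves as both \<open>B\<close> and
      \<open>B'\<close>.\<close>
    define hs where "hs = concat (map (\<lambda>g. map ((*) g) gs) gs)"
    have "length hs = d * d"
      unfolding hs_def by (simp add: length_concat comp_def sum_list_triv gs(1))
    then have "card (additive_span gs) * card (additive_span hs) \<le> p ^ d * p ^ (d * d)"
      using card_additive_span[OF p, of gs] card_additive_span[OF p, of hs] gs(1)
      by (intro mult_le_mono) auto
    also have "\<dots> \<le> (2 ^ p) ^ (d + d * d)"
      unfolding power_add[symmetric] by (intro power_mono) (auto simp: less_imp_le)
    also have "\<dots> \<le> 2 ^ (p * (d + 1)\<^sup>2)"
      unfolding power_mult[symmetric] by (intro power_increasing) (auto simp: power2_eq_square algebra_simps)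
    finally have "card (additive_span gs) * card (additive_span hs) \<le> 2 ^ (p * (d + 1)\<^sup>2)" .
    moreover have "a * x + b \<in> additive_span hs"
      if "a \<in> additive_span gs" "x \<in> additive_span gs" "b \<in> additive_span hs" for a x b
      using additive_span_add[OF additive_span_mult[OF that(1,2)], of b] that(3)
      unfolding hs_def by simp
    moreover have "additive_span hs \<noteq> {}" using additive_span_zero by blast
    ultimately show "\<exists>A B B' :: 'k set. finite A \<and> finite B \<and> finite B' \<and> B \<noteq> {} \<and>
        (\<forall>a\<in>A. \<forall>x\<in>A. \<forall>b\<in>B. a * x + b \<in> B') \<and> card B' \<le> 2 * card B \<and>
        2 ^ d \<le> card A \<and> card A * card B \<le> 2 ^ (p * (d + 1)\<^sup>2)"
      using gs(2) card_additive_span[OF p] by (metis mult_2 le_add1)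
  qed
qed

text \<open>At \<open>r = 2 * m\<close> the power is the square of \<open>2 ^ m\<close>, hence at
  least that of \<open>m + 1\<close>, and this already exceeds the linear side.\<close>

lemma linear_less_power2: "\<exists>r. a + b * r < 2 ^ r" for a b :: nat
proof -
  define m where "m = a + 2 * b"
  have "a + b * (2 * m) < Suc m * Suc m" unfolding m_def by (simp add: algebra_simps)
  also have "\<dots> \<le> 2 ^ m * 2 ^ m" by (intro mult_le_mono) (simp_all add: Suc_leI)
  also have "\<dots> = 2 ^ (2 * m)" by (simp add: mult_2 power_add)
  finally show ?thesis by blast
qed

lemma polynomial_less_power2: "\<exists>d. 3 * (c * (d + 1)\<^sup>2 + 3) ^ s < (2 :: nat) ^ d" for c s :: nat
proof -
  \<comment> \<open>The 3 is 2 from \<open>3 \<le> 2 ^ 2\<close> plus 1 from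
    \<open>d = 2 ^ r - 1\<close>.\<close>
  obtain r where r: "(3 + (c + 3) * s) + 2 * s * r < 2 ^ r"
    using linear_less_power2 by blast
  \<comment> \<open>With \<open>d + 1\<close> a power of two only exponents are compared, a linear
    one in \<open>r\<close> against \<open>2 ^ r - 1\<close>.\<close>
  define d where "d = 2 ^ r - (1 :: nat)"
  have d: "d + 1 = 2 ^ r" by (simp add: d_def)
  have "c * (d + 1)\<^sup>2 + 3 \<le> (c + 3) * (d + 1)\<^sup>2" by (simp add: algebra_simps)
  also have "\<dots> \<le> 2 ^ (c + 3) * (2 ^ r)\<^sup>2"
    unfolding d by (intro mult_le_mono) (simp_all add: less_imp_le del: power_add)
  finally have "(c * (d + 1)\<^sup>2 + 3) ^ s \<le> (2 ^ (c + 3) * (2 ^ r)\<^sup>2) ^ s" by (intro power_mono) simp_all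
  also have "\<dots> = 2 ^ ((c + 3) * s + 2 * s * r)"
    by (simp add: algebra_simps flip: power_mult power_add)
  finally have "3 * (c * (d + 1)\<^sup>2 + 3) ^ s \<le> 4 * 2 ^ ((c + 3) * s + 2 * s * r)" by simp
  also have "\<dots> = 2 ^ (2 + (c + 3) * s + 2 * s * r)" by (simp add: power_add)
  also have "\<dots> < 2 ^ d" using r d by (intro power_strict_increasing) linarith+
  finally show ?thesis by blast
qed

section \<open>Incidences of points and lines\<close>

definition incident :: "'k :: field \<times> 'k \<Rightarrow> 'k \<times> 'k \<Rightarrow> bool" where
  "incident P L \<longleftrightarrow> snd P = fst L * fst P + snd L"

text \<open>Subtracting the four equations shows that the slopes or the abscissas agree; then so do
  the intercepts or the ordinates.\<close>

lemma K22_free_incident: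
  fixes P L :: "('k :: field \<times> 'k) set"
  shows "K22_free incident P L"
  unfolding K22_free_def
proof (intro ballI impI)
  fix p q l l' :: "'k \<times> 'k"
  assume h: "incident p l \<and> incident p l' \<and> incident q l \<and> incident q l'"
  then have "(fst l - fst l') * (fst p - fst q) = 0"
    unfolding incident_def by algebra
  then have "fst l = fst l' \<or> fst p = fst q" by simp
  then show "p = q \<or> l = l'" using h unfolding incident_def by (auto simp: prod_eq_iff)
qed

lemma card_incidences:
  assumes "finite A" "finite B" "finite B'" and "\<forall>a\<in>A. \<forall>x\<in>A. \<forall>b\<in>B. a * x + b \<in> B'"
  shows "card A * (card A * card B) \<le> card (edges incident (A \<times> B') (A \<times> B))"
proof -
  let ?f = "\<lambda>(x, a, b). ((x, a * x + b), (a, b))"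
  have "card (A \<times> A \<times> B) = card (?f ` (A \<times> A \<times> B))"
    by (intro card_image[symmetric]) (auto simp: inj_on_def)
  also have "\<dots> \<le> card (edges incident (A \<times> B') (A \<times> B))"
    using assms by (intro card_mono finite_edges) (auto simp: edges_def incident_def)
  finally show ?thesis by (simp add: card_cartesian_product)
qed

text \<open>Each line of the grid has at least \<open>card A \<ge> 2 ^ d\<close> incidences, whereas
  the edge bound allows on average only polynomially many in \<open>d\<close>.\<close>

lemma incident_not_determined_by_ferrers:
  assumes inf: "infinite (UNIV :: 'k :: field set)"
    and Rs: "\<forall>R\<in>set Rs. ferrers R"
    and det: "determined_by Rs (incident :: 'k \<times> 'k \<Rightarrow> _) UNIV UNIV"
  shows False
proof -
  obtain c where c: "\<And>d. \<exists>A B B' :: 'k set. finite A \<and> finite B \<and> finite B' \<and> B \<noteq> {} \<and>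
      (\<forall>a\<in>A. \<forall>x\<in>A. \<forall>b\<in>B. a * x + b \<in> B') \<and> card B' \<le> 2 * card B \<and>
      2 ^ d \<le> card A \<and> card A * card B \<le> 2 ^ (c * (d + 1)\<^sup>2)"
    using multiplicative_grid[OF inf] by blast
  obtain d where d: "3 * (c * (d + 1)\<^sup>2 + 3) ^ length Rs < (2 :: nat) ^ d"
    using polynomial_less_power2 by blast
  obtain A B B' :: "'k set" where fin: "finite A" "finite B" "finite B'" and "B \<noteq> {}"
    and closed: "\<forall>a\<in>A. \<forall>x\<in>A. \<forall>b\<in>B. a * x + b \<in> B'"
    and B': "card B' \<le> 2 * card B" and A: "2 ^ d \<le> card A"
    and AB: "card A * card B \<le> 2 ^ (c * (d + 1)\<^sup>2)"
    using c[of d] by blast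
  \<comment> \<open>The 2 pays for the factor 3 in the vertex count, as
    \<open>3 \<le> 2 ^ 2\<close>.\<close>
  let ?k = "c * (d + 1)\<^sup>2 + 2" and ?N = "card A * card B"
  have "0 < ?N" using A \<open>B \<noteq> {}\<close> fin by (auto simp: card_gt_0_iff intro: gr0I)
  have "card A * card B' \<le> card A * (2 * card B)" by (intro mult_le_mono B') simp
  then have size: "card (A \<times> B') + card (A \<times> B) \<le> 3 * ?N"
    by (simp add: card_cartesian_product)
  also have "\<dots> \<le> 2 ^ ?k" using AB by simp
  finally have k: "card (A \<times> B') + card (A \<times> B) \<le> 2 ^ ?k" .
  have "card A * ?N \<le> card (edges incident (A \<times> B') (A \<times> B))"
    using card_incidences[OF fin closed] .
  also have "\<dots> \<le> (card (A \<times> B') + card (A \<times> B)) * (?k + 1) ^ length Rs"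
    using card_edges_bound[OF Rs determined_by_mono[OF det] K22_free_incident _ _ k] fin by simp
  also have "\<dots> \<le> 3 * ?N * (?k + 1) ^ length Rs" by (intro mult_le_mono size) simp
  finally have "?N * card A \<le> ?N * (3 * (?k + 1) ^ length Rs)" by (simp add: mult_ac)
  with \<open>0 < ?N\<close> have "card A \<le> 3 * (?k + 1) ^ length Rs"
    using mult_le_cancel1 by blast
  then have "\<not> 3 * (?k + 1) ^ length Rs < 2 ^ d" using A by (metis leD le_trans)
  moreover have "?k + 1 = c * (d + 1)\<^sup>2 + 3" by simp
  ultimately show False using d by metis
qed

theorem theorem6p6:
  fixes scale ::
    "'d :: {division_ring, linordered_ring_strict} \<Rightarrow> 'v :: linordered_ab_group_add \<Rightarrow> 'v"
  assumes "ordered_vector_space scale"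
    and "infinite (UNIV :: 'k :: field set)"
  shows "\<not> trace_defines (ovs_structure scale)
           (field_structure :: (field_fun, unit, 'k) fo_structure)"
proof
  let ?M = "ovs_structure scale" and ?F = "field_structure :: (field_fun, unit, 'k) fo_structure"
  interpret ordered_vector_space scale by (rule assms(1))
  assume "trace_defines ?M ?F"
  then obtain m and \<tau> :: "'k \<Rightarrow> 'v list" where len: "\<And>b. length (\<tau> b) = m" and "inj \<tau>"
    and trace: "\<And>n X. definable ?F n X \<Longrightarrow> \<exists>Y. definable ?M (m * n) Y \<and>
      (\<forall>bs. length bs = n \<longrightarrow> (bs \<in> X \<longleftrightarrow> concat (map \<tau> bs) \<in> Y))"
    unfolding trace_defines_def by blast
  \<comment> \<open>Two field elements have distinct images, so the space is nontrivial: a nonzero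
    difference of entries or its negative is the positive \<open>u\<close>.\<close>
  have "\<tau> 0 \<noteq> \<tau> 1" using \<open>inj \<tau>\<close> by (simp add: inj_eq)
  then obtain i where "\<tau> 0 ! i \<noteq> \<tau> 1 ! i" using len by (metis nth_equalityI)
  then obtain u :: 'v where u: "0 < u"
    by (metis diff_gt_0_iff_gt linorder_neqE)
  \<comment> \<open>Variables 0 to 3 stand for \<open>x\<close>, \<open>y\<close>, \<open>a\<close>,
    \<open>b\<close> in \<open>y = a * x + b\<close>.\<close>
  define q :: "(field_fun, unit) fm" where
    "q = Eql (Var 1) (App FPlus [App FTimes [Var 2, Var 0], Var 3])"
  define X where "X = {xs. length xs = 4 \<and> sat ?F (\<lambda>i. if i < 4 then xs ! i else 0) q}"
  have "definable ?F 4 X"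
    unfolding definable_def X_def
    by (intro exI[of _ q] exI[of _ "\<lambda>_. 0"]) (simp add: q_def field_structure_def)
  from trace[OF this] obtain Y where "definable ?M (m * 4) Y"
    and Y: "\<And>bs. length bs = 4 \<Longrightarrow> bs \<in> X \<longleftrightarrow> concat (map \<tau> bs) \<in> Y" by blast
  then obtain p e where "wf_fm ?M p"
    and Y_def: "Y = {xs. length xs = m * 4 \<and> sat ?M (\<lambda>i. if i < m * 4 then xs ! i else e i) p}"
    unfolding definable_def by blast
  \<comment> \<open>The first \<open>2 * m\<close> variables carry the point, hence the offset in
    \<open>g\<close> for the line. The parameters \<open>e\<close> are counted with the line, so
    each variable depends on only one of \<open>P\<close> and \<open>L\<close>.\<close>
  define f where "f P i = (\<tau> (fst P) @ \<tau> (snd P)) ! i" for P i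
  define g where "g L i = (if i < m * 4 then (\<tau> (fst L) @ \<tau> (snd L)) ! (i - 2 * m) else e i)" for L i
  define h where "h P L i = (if i < 2 * m then f P i else g L i)" for P L i
  have "incident P L \<longleftrightarrow> sat ?M (h P L) p" for P L :: "'k \<times> 'k"
  proof -
    let ?bs = "[fst P, snd P, fst L, snd L]"
    have "incident P L \<longleftrightarrow> ?bs \<in> X"
      by (simp add: X_def q_def incident_def field_structure_def)
    also have "\<dots> \<longleftrightarrow> concat (map \<tau> ?bs) \<in> Y" by (rule Y) simp
    also have "\<dots> \<longleftrightarrow> sat ?M (\<lambda>i. if i < m * 4 then concat (map \<tau> ?bs) ! i else e i) p"
    proof -
      have "length (concat (map \<tau> ?bs)) = m * 4" by (simp add: len)
      then show ?thesis unfolding Y_def by blast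
    qed
    also have "(\<lambda>i. if i < m * 4 then concat (map \<tau> ?bs) ! i else e i) = h P L"
    proof
      have "concat (map \<tau> ?bs) = (\<tau> (fst P) @ \<tau> (snd P)) @ (\<tau> (fst L) @ \<tau> (snd L))" by simp
      moreover have "length (\<tau> (fst P) @ \<tau> (snd P)) = 2 * m" by (simp add: len)
      ultimately show "(if i < m * 4 then concat (map \<tau> ?bs) ! i else e i) = h P L i" for i
        unfolding h_def f_def g_def by (simp only: nth_append[of "\<tau> (fst P) @ \<tau> (snd P)"]) simp
    qed
    finally show ?thesis .
  qed
  then have eq: "incident = (\<lambda>P L. sat ?M (h P L) p)" by blast
  show False
    using semilinear_determined_by_ferrers[where h = h, OF semilinear_sat[OF u \<open>wf_fm ?M p\<close>] h_def]
      incident_not_determined_by_ferrers[OF assms(2)]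
    unfolding eq[symmetric] by blast
qed

end
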